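(* Let $p$ be a prime with $p\equiv 1\pmod 4$. Then for $M=(p-1)/4$ and also for $M=p-1$, $$\sum_{k=0}^{M}(-1)^k(8k+1)\frac{(\frac14)_k^3}{k!^3}\equiv p(-1)^{(p-1)/4}+\frac{p^3}{16}E_{p-3}\left(\tfrac14\right)\pmod{p^4}.$$
   Context: $(x)_k=x(x+1)\cdots(x+k-1)$ is the Pochhammer symbol, with $(x)_0=1$. The Euler polynomials $E_n(x)$ are defined by $\sum_{n\ge 0}E_n(x)\frac{t^n}{n!}=\frac{2e^{xt}}{e^t+1}$. A congruence modulo $p^4$ between rational numbers whose denominators are prime to $p$ means that the difference lies in $p^4\mathbb{Z}_p$, where $\mathbb{Z}_p$ is the ring of $p$-adic integers. *)

theory Defs
  imports
    "HOL-Computational_Algebra.Formal_Power_Series"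
    "HOL-Computational_Algebra.Primes"
begin

text \<open>The ring of \<open>p\<close>-adic integers is used only through its intersection with the rational
  numbers, which consists of the fractions whose reduced denominator is prime to \<open>p\<close>.\<close>

definition p_integral_rats :: "nat \<Rightarrow> rat set" where
  "p_integral_rats p = {x. coprime (snd (quotient_of x)) (int p)}"

definition rat_cong_prime_power :: "nat \<Rightarrow> nat \<Rightarrow> rat \<Rightarrow> rat \<Rightarrow> bool" where
  "rat_cong_prime_power p n x y \<longleftrightarrow> (\<exists>z \<in> p_integral_rats p. x - y = of_nat p ^ n * z)"

text \<open>For fixed \<open>x\<close>, the exponential generating function \<open>2 e\<^sup>x\<^sup>t / (e\<^sup>t + 1)\<close> as a formal power
  series in \<open>t\<close>. Its denominator has constant term 2, so the quotient is exact.\<close>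

definition euler_poly_egf :: "'a :: field_char_0 \<Rightarrow> 'a fps" where
  "euler_poly_egf x = 2 * fps_exp x / (fps_exp 1 + 1)"

definition euler_poly :: "nat \<Rightarrow> 'a :: field_char_0 \<Rightarrow> 'a" where
  "euler_poly n x = fact n * fps_nth (euler_poly_egf x) n"

lemma euler_poly_generating_function:
  fixes x :: "'a :: field_char_0"
  shows "Abs_fps (\<lambda>n. euler_poly n x / fact n) * (fps_exp 1 + 1) = 2 * fps_exp x"
proof -
  have "Abs_fps (\<lambda>n. euler_poly n x / fact n) = euler_poly_egf x"
    by (simp add: fps_eq_iff euler_poly_def)
  moreover have "fps_nth (fps_exp 1 + 1 :: 'a fps) 0 \<noteq> 0"
    by simp
  ultimately show ?thesis
    by (simp add: euler_poly_egf_def fps_divide_unit mult.assoc inverse_mult_eq_1)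
qed

end

theory Submission
  imports Defs "HOL-Computational_Algebra.Polynomial" "HOL-Number_Theory.Residues"
begin

text \<open>
  Write \<open>n = (p - 1) / 4\<close> and \<open>y m = (1/4 + m)\<^sup>2\<close>, and deform the sum up to \<open>n\<close> into the polynomial
  \<open>P(y) = (\<Sum>k\<le>n. (-1)\<^sup>k (8k + 1) (1/4)\<^sub>k / k! (\<Prod>j<k. y j - y) (\<Prod>k<j\<le>n. j\<^sup>2 - y))\<close> of degree at most \<open>n\<close>,
  so that \<open>P(0)\<close> is \<open>n!\<^sup>2\<close> times the sum. At the \<open>n + 1\<close> points \<open>y m\<close> with \<open>m \<le> n\<close> the sum becomes
  a terminating very-well-poised \<open>4F3(-1)\<close>, which has a closed form, and Lagrange interpolation
  recovers \<open>P(0)\<close>. Since \<open>y n = p\<^sup>2/16\<close> and \<open>y (n - j) \<equiv> j\<^sup>2\<close> modulo \<open>p\<close>, the interpolation formula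
  collapses modulo \<open>p\<^sup>4\<close>: the node \<open>m = n\<close> contributes \<open>(-1)\<^sup>n p\<close> and the node \<open>m = n - j\<close> contributes
  \<open>(-1)\<^sup>m p\<^sup>3 / (8 j\<^sup>2)\<close>. By Fermat's little theorem and the difference equation of the Euler polynomials
  the latter add up to \<open>p\<^sup>3/16\<close> times the value of the Euler polynomial of degree \<open>p - 3\<close> at
  \<open>-n \<equiv> 1/4\<close>. The terms with \<open>n < k < p\<close> are divisible by \<open>p\<^sup>3\<close>, and those at \<open>k\<close> and \<open>p + n - k\<close>
  cancel modulo \<open>p\<^sup>4\<close>.
\<close>

subsection \<open>Summation and interpolation\<close>

text \<open>Since \<open>a + 2 * k\<close> is \<open>a * (1 + a/2)_k / (a/2)_k\<close>, this is the
  limit of the terminating very-well-poised \<open>5F4(1)\<close> sum as one parameter tends to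
  infinity. The normalised sum is shown to be independent of \<open>m\<close>.\<close>

lemma well_poised_4F3_sum:
  fixes a b :: "'a :: field_char_0"
  assumes a: "\<And>i. a + of_nat i \<noteq> 0" and ab: "\<And>i. 1 + a - b + of_nat i \<noteq> 0"
  shows "(\<Sum>k\<le>m. (-1) ^ k * (a + 2 * of_nat k) * pochhammer a k * pochhammer b k *
      pochhammer (- of_nat m) k
             / (fact k * pochhammer (1 + a - b) k * pochhammer (1 + a + of_nat m) k))
         = a * pochhammer (1 + a) m / pochhammer (1 + a - b) m"
proof -
  \<comment> \<open>\<open>F m k\<close> is the normalised summand and \<open>(F, -H)\<close>, up to a shift of \<open>k\<close>, a Wilf-Zeilberger pair.\<close>
  define c where "c m k = (-1) ^ k * pochhammer a k * pochhammer b k * pochhammer (- of_nat m) k *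
      pochhammer (1 + a - b) m
     / (fact k * pochhammer (1 + a - b) k * pochhammer (1 + a) (m + k))" for m k
  define F where "F m k = (a + 2 * of_nat k) * c m k" for m k
  define H where "H m k = (a + of_nat k) * (b + of_nat k) / (1 + a + of_nat m + of_nat k) * c m k"
      for m k
  have a': "1 + a + of_nat i \<noteq> 0" for i
    using a[of "Suc i"] by (simp add: add_ac)
  have a'': "1 + a + of_nat i + of_nat j \<noteq> 0" for i j
    using a'[of "i + j"] by (simp add: add_ac)
  have nz: "pochhammer (1 + a) i \<noteq> 0" "pochhammer (1 + a - b) i \<noteq> 0" for i
    using a' ab by (auto simp: pochhammer_eq_0_iff eq_neg_iff_add_eq_0)
  have step: "F (Suc m) (Suc k) - F m (Suc k) = H m k - H m (Suc k)" for m k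
  proof -
    \<comment> \<open>\<open>d\<close> absorbs all denominators of the ratios, so that the three
      neighbouring values of \<open>c\<close> become polynomial multiples of it.\<close>
    define d where "d = c m k / ((of_nat k + 1) * (1 + a - b + of_nat k) * (1 + a + of_nat m +
        of_nat k) * (2 + a + of_nat m + of_nat k))"
    have k1: "of_nat k + 1 \<noteq> (0 :: 'a)" "2 + a + of_nat m + of_nat k \<noteq> 0"
      using of_nat_neq_0[of k] a''[of "Suc m" k] by (auto simp: add_ac)
    define u where "u = of_nat m - (of_nat k :: 'a)"
    define e where "e = 1 + a - b"
    have N1: "pochhammer (- of_nat m :: 'a) (Suc k) = - (pochhammer (- of_nat m) k * u)"
      by (simp add: pochhammer_Suc u_def algebra_simps)
    have N2: "pochhammer (- of_nat (Suc m) :: 'a) (Suc k) = - ((of_nat m + 1) *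
        pochhammer (- of_nat m) k)"
      by (subst pochhammer_rec) (simp add: algebra_simps)
    have c1: "c m (Suc k) = (a + of_nat k) * (b + of_nat k) * (of_nat m - of_nat k) * (2 + a +
        of_nat m + of_nat k) * d"
    proof -
      have "c m (Suc k) = c m k * ((a + of_nat k) * (b + of_nat k) * (of_nat m - of_nat k) /
          ((of_nat k + 1) * (1 + a - b + of_nat k) * (1 + a + of_nat m + of_nat k)))"
        unfolding c_def N1 by (simp add: pochhammer_Suc ac_simps flip: u_def e_def)
      then show ?thesis
        using k1 by (simp add: d_def mult_ac)
    qed
    have c2: "c (Suc m) (Suc k) = (a + of_nat k) * (b + of_nat k) * (of_nat m + 1) * (1 + a - b +
        of_nat m) * d"
    proof -
      have "c (Suc m) (Suc k) = c m k * ((a + of_nat k) * (b + of_nat k) * (of_nat m + 1) * (1 +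
          a - b + of_nat m) /
          ((of_nat k + 1) * (1 + a - b + of_nat k) * (1 + a + of_nat m + of_nat k) * (2 + a +
              of_nat m + of_nat k)))"
        unfolding c_def N2 by (simp add: pochhammer_Suc ac_simps flip: e_def)
      then show ?thesis
        using k1 by (simp add: d_def)
    qed
    have c0: "c m k = (of_nat k + 1) * (1 + a - b + of_nat k) * (1 + a + of_nat m + of_nat k) * (2 +
        a + of_nat m + of_nat k) * d"
      using k1 a'' ab[of k] by (simp add: d_def)
    define X where "X = (a + of_nat k) * (b + of_nat k) * d"
    have H1: "H m k = X * ((of_nat k + 1) * (1 + a - b + of_nat k) * (2 + a + of_nat m + of_nat k))"
      using a''[of m k] by (simp add: H_def c0 X_def mult_ac)
    have "2 + a + of_nat m + of_nat k = 1 + a + of_nat m + of_nat (Suc k)"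
      by simp
    then have H2: "H m (Suc k) = X * ((a + of_nat k + 1) * (b + of_nat k + 1) * (of_nat m - of_nat k))"
      using a''[of m "Suc k"] unfolding H_def c1 X_def by (simp add: mult_ac add_ac)
    have F: "F (Suc m) (Suc k) - F m (Suc k) =
        X * ((a + 2 * (of_nat k + 1)) * ((of_nat m + 1) * (1 + a - b + of_nat m) -
          (of_nat m - of_nat k) * (2 + a + of_nat m + of_nat k)))"
      unfolding F_def c1 c2 X_def by (simp add: algebra_simps)
    \<comment> \<open>After removal of the common factor \<open>X\<close>, only this polynomial
      identity is left.\<close>
    have "(a + 2 * (K + 1)) * ((M + 1) * (1 + a - b + M) - (M - K) * (2 + a + M + K)) =
       (K + 1) * (1 + a - b + K) * (2 + a + M + K) - (a + K + 1) * (b + K + 1) * (M - K)" for K M :: 'a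
      by (simp add: algebra_simps)
    then show ?thesis
      unfolding F H1 H2 by (simp only: right_diff_distrib)
  qed
  have tele: "(\<Sum>k\<le>K. F (Suc m) k - F m k) = - H m K" for m K
  proof (induction K)
    case 0
    \<comment> \<open>At \<open>k = 0\<close> the difference equals \<open>- H m 0\<close>, so the
      telescoping has no lower boundary term.\<close>
    have "c (Suc m) 0 = (1 + a + of_nat m - b) / (1 + a + of_nat m) * c m 0"
      by (simp add: c_def pochhammer_Suc algebra_simps)
    also have "\<dots> = c m 0 - b / (1 + a + of_nat m) * c m 0"
      using a''[of m 0] by (simp add: diff_divide_distrib left_diff_distrib)
    finally show ?case
      by (simp add: F_def H_def right_diff_distrib)
  next
    case (Suc K)
    then show ?case
      using step[of m K] by simp
  qed
  have "(\<Sum>k\<le>m. F m k) = a"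
  proof (induction m)
    case 0
    show ?case by (simp add: F_def c_def)
  next
    case (Suc m)
    \<comment> \<open>The sum for \<open>m\<close> may thus be extended to \<open>k = Suc m\<close>,
      where the upper boundary term \<open>H\<close> vanishes as well.\<close>
    have "pochhammer (- of_nat m :: 'a) (Suc m) = 0"
      by (simp add: pochhammer_of_nat_eq_0_lemma)
    then have "c m (Suc m) = 0"
      by (simp add: c_def)
    then have "F m (Suc m) = 0" "H m (Suc m) = 0"
      by (simp_all add: F_def H_def)
    with tele[of m "Suc m"] Suc show ?case
      by (simp add: sum_subtractf)
  qed
  then have sum: "(\<Sum>k\<le>m. F m k * (pochhammer (1 + a) m / pochhammer (1 + a - b) m)) = a *
      pochhammer (1 + a) m / pochhammer (1 + a - b) m"
    using sum_distrib_right[of "F m" "{..m}" "pochhammer (1 + a) m / pochhammer (1 + a - b) m"] by simp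
  have "F m k * (pochhammer (1 + a) m / pochhammer (1 + a - b) m) =
      (-1) ^ k * (a + 2 * of_nat k) * pochhammer a k * pochhammer b k * pochhammer (- of_nat m) k
             / (fact k * pochhammer (1 + a - b) k * pochhammer (1 + a + of_nat m) k)" for k
    unfolding F_def c_def pochhammer_product' using nz[of m] by (simp add: mult_ac)
  from sum[unfolded this] show ?thesis .
qed

text \<open>\<open>P\<close> and its Lagrange interpolant \<open>L\<close> have degree below
  \<open>card A\<close> and agree at \<open>card A\<close> distinct points, so they
  coincide.\<close>

lemma lagrange_at_0:
  fixes P :: "'a :: field poly" and y :: "'b \<Rightarrow> 'a"
  assumes A: "finite A" and y: "inj_on y A" and P: "degree P < card A"
  shows "poly P 0 = (\<Sum>m\<in>A. poly P (y m) * (\<Prod>i\<in>A - {m}. y i / (y i - y m)))"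
proof -
  define B where "B m = (\<Prod>i\<in>A - {m}. Polynomial.smult (inverse (y m - y i)) [:- y i, 1:])" for m
  define L where "L = (\<Sum>m\<in>A. Polynomial.smult (poly P (y m)) (B m))"
  have "degree (B m) < card A" if "m \<in> A" for m
  proof -
    have "degree (B m) \<le> (\<Sum>i\<in>A - {m}. degree (Polynomial.smult (inverse (y m - y i)) [:- y i, 1:]))"
      unfolding B_def using A by (intro degree_prod_sum_le[unfolded comp_def]) auto
    also have "\<dots> \<le> (\<Sum>i\<in>A - {m}. 1)"
      by (intro sum_mono) simp
    also have "\<dots> < card A"
      using card_Diff1_less[OF A that] by simp
    finally show ?thesis .
  qed
  then have "degree L < card A"
    unfolding L_def using P by (intro degree_sum_less) (auto intro: le_less_trans[OF degree_smult_le])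
  moreover have "poly (B m) (y j) = (if m = j then 1 else 0)" if "m \<in> A" "j \<in> A" for m j
  proof (cases "m = j")
    case True
    have "y j - y i \<noteq> 0" if "i \<in> A - {j}" for i
      using that \<open>j \<in> A\<close> y by (auto simp: inj_on_def)
    with True show ?thesis
      by (auto simp: B_def poly_prod left_diff_distrib[symmetric] mult.commute intro!: prod.neutral)
  next
    case False
    with that A show ?thesis
      by (auto simp: B_def poly_prod intro!: prod_zero)
  qed
  then have "poly L (y j) = (\<Sum>m\<in>A. if m = j then poly P (y m) else 0)" if "j \<in> A" for j
    using that by (auto simp: L_def poly_sum intro!: sum.cong)
  then have "poly L (y j) = poly P (y j)" if "j \<in> A" for j
    using that A by simp
  ultimately have "P = L"
    using P by (intro poly_eqI_degree[of "y ` A"]) (auto simp: card_image[OF y])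
  then have "poly P 0 = poly L 0"
    by simp
  also have "\<dots> = (\<Sum>m\<in>A. poly P (y m) * (\<Prod>i\<in>A - {m}. - y i / (y m - y i)))"
    by (simp add: L_def B_def poly_sum poly_prod divide_inverse mult.commute)
  also have "\<dots> = (\<Sum>m\<in>A. poly P (y m) * (\<Prod>i\<in>A - {m}. y i / (y i - y m)))"
    by (metis (no_types, lifting) minus_diff_eq minus_divide_divide minus_minus prod.cong sum.cong)
  finally show ?thesis .
qed

text \<open>The case \<open>a = 1/4\<close>, \<open>b = 1/2 + m\<close> of the summation, multiplied
  by 4. Reversing the product gives \<open>(3/4 - m)_m = (-1)^m (1/4)_m\<close>, so the closed form
  collapses.\<close>

lemma quarter_sum:
  "(\<Sum>k\<le>m. (-1) ^ k * (8 * of_nat k + 1) * pochhammer (1/4 :: rat) k * (pochhammer (- of_nat m) k *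
      pochhammer (1/2 + of_nat m) k)
       / (fact k * (pochhammer (3/4 - of_nat m) k * pochhammer (5/4 + of_nat m) k))) = (-1) ^ m *
           (4 * of_nat m + 1)"
proof -
  have a: "1/4 + of_nat i \<noteq> (0 :: rat)" for i
    by (simp add: add_nonneg_eq_0_iff)
  have b: "1 + 1/4 - (1/2 + of_nat m) + of_nat i \<noteq> (0 :: rat)" for i
  proof
    assume "1 + 1/4 - (1/2 + of_nat m) + of_nat i = (0 :: rat)"
    then have "of_nat (3 + 4 * i) = (of_nat (4 * m) :: rat)"
      by (simp add: field_simps)
    \<comment> \<open>Impossible modulo 4, so no lower parameter produces a zero
      denominator.\<close>
    then have "3 + 4 * i = 4 * m"
      by (simp only: of_nat_eq_iff)
    then show False
      by presburger
  qed
  have e: "3/4 - of_nat m = - (of_nat m - 3/4 :: rat)" "of_nat m - 3/4 - of_nat m + 1 = (1/4 :: rat)"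
    by simp_all
  have "pochhammer (3/4 - of_nat m :: rat) m = (-1) ^ m * pochhammer (1/4) m"
    unfolding e(1) pochhammer_minus e(2) ..
  moreover have "(1/4 :: rat) * pochhammer (5/4) m = pochhammer (1/4) m * (1/4 + of_nat m)"
    using pochhammer_rec[of "1/4 :: rat" m] by (simp add: pochhammer_Suc)
  moreover have "pochhammer (1/4 :: rat) m \<noteq> 0"
    using pochhammer_pos[of "1/4 :: rat" m] by simp
  ultimately have r: "(1/4 :: rat) * pochhammer (1 + 1/4) m / pochhammer (3/4 - of_nat m) m =
      (-1) ^ m * (1/4 + of_nat m)"
    by (cases "even m") simp_all
  have d: "1 + 1/4 - (1/2 + of_nat m) = (3/4 - of_nat m :: rat)" "1 + 1/4 + of_nat m = (5/4 +
      of_nat m :: rat)"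
    by simp_all
  have "(\<Sum>k\<le>m. (-1) ^ k * (8 * of_nat k + 1) * pochhammer (1/4 :: rat) k *
      (pochhammer (- of_nat m) k * pochhammer (1/2 + of_nat m) k)
       / (fact k * (pochhammer (3/4 - of_nat m) k * pochhammer (5/4 + of_nat m) k)))
     = 4 * (\<Sum>k\<le>m. (-1) ^ k * (1/4 + 2 * of_nat k) * pochhammer (1/4 :: rat) k * pochhammer (1/2 +
         of_nat m) k * pochhammer (- of_nat m) k
       / (fact k * pochhammer (3/4 - of_nat m) k * pochhammer (5/4 + of_nat m) k))"
    unfolding sum_distrib_left
  proof (intro sum.cong refl)
    show "(-1) ^ k * (8 * of_nat k + 1) * x * (y * z) / (f * (u * v)) =
        4 * ((-1) ^ k * (1/4 + 2 * of_nat k) * x * z * y / (f * u * v))" for k and f u v x y z :: rat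
    proof -
      have "8 * of_nat k + 1 = 4 * (1/4 + 2 * of_nat k :: rat)"
        by simp
      then show ?thesis
        by (simp only: times_divide_eq_right mult_ac)
    qed
  qed
  also have "\<dots> = 4 * ((-1) ^ m * (1/4 + of_nat m))"
    unfolding r[symmetric] using well_poised_4F3_sum[OF a b, of m, unfolded d] by (simp only:)
  also have "\<dots> = (-1) ^ m * (4 * of_nat m + 1)"
    by (simp add: algebra_simps)
  finally show ?thesis .
qed

section \<open>The nodes and the deformed sum\<close>

definition node :: "nat \<Rightarrow> rat" where
  "node m = (1/4 + of_nat m)\<^sup>2"

lemma node_diff: "node i - node j = (of_nat i - of_nat j) * (1/2 + of_nat i + of_nat j)"
  by (simp add: node_def power2_eq_square field_simps)

lemma inj_node: "inj node"
  by (auto simp: inj_def node_def power2_eq_iff_nonneg)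

text \<open>This factorisation and the next one, both differences of squares, turn the products of
  the deformed sum at \<open>node m\<close> into the Pochhammer symbols of
  \<open>quarter_sum\<close>.\<close>

lemma prod_node_diff:
  "(\<Prod>j<k. node j - node m) = pochhammer (- of_nat m) k * pochhammer (1/2 + of_nat m) k"
  unfolding pochhammer_prod lessThan_atLeast0 prod.distrib[symmetric]
  by (intro prod.cong refl) (simp add: node_diff algebra_simps)

lemma prod_square_minus_node:
  "(\<Prod>j<k. (of_nat (Suc j))\<^sup>2 - node m) = pochhammer (3/4 - of_nat m) k * pochhammer (5/4 + of_nat m) k"
  unfolding pochhammer_prod lessThan_atLeast0 prod.distrib[symmetric]
  by (intro prod.cong refl) (simp add: node_def power2_eq_square field_simps)

lemma square_minus_node_nonzero: "(of_nat j)\<^sup>2 - node m \<noteq> 0"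
proof
  assume "(of_nat j)\<^sup>2 - node m = 0"
  then have "of_nat j = 1/4 + (of_nat m :: rat)"
    by (simp add: node_def power2_eq_iff_nonneg)
  then have "of_nat (4 * j) = (of_nat (1 + 4 * m) :: rat)"
    by (simp add: field_simps)
  then have "4 * j = 1 + 4 * m"
    by (simp only: of_nat_eq_iff)
  then show False
    by presburger
qed

abbreviation summand :: "nat \<Rightarrow> rat" where
  "summand k \<equiv> (-1) ^ k * (8 * of_nat k + 1) * pochhammer (1/4 :: rat) k ^ 3 / fact k ^ 3"

text \<open>Multiplying by all \<open>j^2 - y\<close> with \<open>1 \<le> j \<le> n\<close> has
  cleared the denominators. Each summand is a product of \<open>k + (n - k) = n\<close> linear
  factors, whence the degree bound.\<close>

definition interpolant :: "nat \<Rightarrow> rat poly" where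
  "interpolant n = (\<Sum>k\<le>n. Polynomial.smult ((-1) ^ k * (8 * of_nat k + 1) * pochhammer (1/4) k / fact k)
     ((\<Prod>j<k. [:node j, -1:]) * (\<Prod>j\<in>{k..<n}. [:(of_nat (Suc j))\<^sup>2, -1:])))"

lemma degree_interpolant: "degree (interpolant n) \<le> n"
  unfolding interpolant_def
proof (intro degree_sum_le order.trans[OF degree_smult_le])
  fix k assume k: "k \<in> {..n}"
  have "degree (\<Prod>j<k. [:node j, -1:]) \<le> k"
    using degree_prod_sum_le[of "{..<k}" "\<lambda>j. [:node j, -1:]"] by simp
  moreover have "degree (\<Prod>j\<in>{k..<n}. [:(of_nat (Suc j))\<^sup>2, -1 :: rat:]) \<le> n - k"
    using degree_prod_sum_le[of "{k..<n}" "\<lambda>j. [:(of_nat (Suc j))\<^sup>2, -1 :: rat:]"] by simp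
  ultimately show "degree ((\<Prod>j<k. [:node j, -1:]) *
      (\<Prod>j\<in>{k..<n}. [:(of_nat (Suc j))\<^sup>2, -1 :: rat:])) \<le> n"
    using k by (intro order.trans[OF degree_mult_le]) simp
qed simp

lemma interpolant_0: "poly (interpolant n) 0 = fact n ^ 2 * (\<Sum>k\<le>n. summand k)"
proof -
  have 1: "(\<Prod>j<k. node j) = pochhammer (1/4) k ^ 2" for k
    by (simp add: pochhammer_prod node_def prod_power_distrib lessThan_atLeast0)
  have 2: "(\<Prod>j\<in>{k..<n}. (of_nat (Suc j) :: rat)\<^sup>2) = fact n ^ 2 / fact k ^ 2" if "k \<le> n" for k
  proof -
    have f: "(\<Prod>j\<in>{0..<i}. of_nat (Suc j)) = (fact i :: rat)" for i
      by (induction i) (auto simp: mult.commute)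
    have "fact k * (\<Prod>j\<in>{k..<n}. of_nat (Suc j)) = (fact n :: rat)"
      unfolding f[symmetric] using that by (intro prod.atLeastLessThan_concat) auto
    then show ?thesis
      by (simp add: field_simps flip: prod_power_distrib power_mult_distrib)
  qed
  show ?thesis
    unfolding interpolant_def poly_sum sum_distrib_left
  proof (intro sum.cong refl)
    fix k assume "k \<in> {..n}"
    with 2 show "poly (Polynomial.smult ((-1) ^ k * (8 * of_nat k + 1) * pochhammer (1/4) k / fact k)
       ((\<Prod>j<k. [:node j, -1:]) * (\<Prod>j\<in>{k..<n}. [:(of_nat (Suc j))\<^sup>2, -1:]))) 0 = fact n ^ 2 * summand k"
      by (simp add: poly_prod 1) (simp add: power2_eq_square power3_eq_cube mult_ac)
  qed
qed

text \<open>For \<open>k > m\<close> the first product contains the zero factor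
  \<open>node m - node m\<close>, so the sum stops at \<open>m\<close> and is the one in
  \<open>quarter_sum\<close>, times the full product \<open>Q n\<close>.\<close>

lemma interpolant_node:
  assumes "m \<le> n"
  shows "poly (interpolant n) (node m) = (-1) ^ m * (4 * of_nat m + 1) *
      (\<Prod>j<n. (of_nat (Suc j))\<^sup>2 - node m)"
proof -
  define Q where "Q k = (\<Prod>j<k. (of_nat (Suc j))\<^sup>2 - node m)" for k
  have Q: "Q k \<noteq> 0" for k
    using square_minus_node_nonzero by (auto simp: Q_def simp del: of_nat_Suc)
  have split: "(\<Prod>j\<in>{k..<n}. (of_nat (Suc j))\<^sup>2 - node m) = Q n / Q k" if "k \<le> n" for k
  proof -
    have "Q k * (\<Prod>j\<in>{k..<n}. (of_nat (Suc j))\<^sup>2 - node m) = Q n"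
      unfolding Q_def lessThan_atLeast0 using that by (intro prod.atLeastLessThan_concat) auto
    with Q[of k] show ?thesis
      by (simp add: field_simps)
  qed
  have "poly (interpolant n) (node m) =
     (\<Sum>k\<le>n. (-1) ^ k * (8 * of_nat k + 1) * pochhammer (1/4 :: rat) k / fact k *
         ((\<Prod>j<k. node j - node m) * (Q n / Q k)))"
    unfolding interpolant_def poly_sum by (intro sum.cong refl) (simp add: poly_prod
        split[symmetric] del: of_nat_Suc)
  also have "\<dots> = (\<Sum>k\<le>m. (-1) ^ k * (8 * of_nat k + 1) * pochhammer (1/4 :: rat) k / fact k *
      ((\<Prod>j<k. node j - node m) * (Q n / Q k)))"
    using assms by (intro sum.mono_neutral_right) auto
  also have "\<dots> = (\<Sum>k\<le>m. (-1) ^ k * (8 * of_nat k + 1) * pochhammer (1/4 :: rat) k *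
      (pochhammer (- of_nat m) k * pochhammer (1/2 + of_nat m) k)
       / (fact k * (pochhammer (3/4 - of_nat m) k * pochhammer (5/4 + of_nat m) k))) * Q n"
    unfolding sum_distrib_right prod_node_diff Q_def prod_square_minus_node
        by (intro sum.cong refl) simp
  finally show ?thesis
    unfolding quarter_sum Q_def .
qed

text \<open>Interpolation at the \<open>n + 1\<close> nodes, after division by
  \<open>fact n ^ 2\<close>, which is spread over the factors of the first product.\<close>

lemma truncated_sum_eq:
  "(\<Sum>k\<le>n. summand k) = (\<Sum>m\<le>n. (-1) ^ m * (4 * of_nat m + 1) *
     (\<Prod>j\<in>{1..n}. ((of_nat j)\<^sup>2 - node m) / (of_nat j)\<^sup>2) * (\<Prod>i\<in>{..n} - {m}. node i /
         (node i - node m)))"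
proof -
  have "fact n ^ 2 * (\<Sum>k\<le>n. summand k) = poly (interpolant n) 0"
    by (rule interpolant_0[symmetric])
  also have "\<dots> = (\<Sum>m\<le>n. poly (interpolant n) (node m) * (\<Prod>i\<in>{..n} - {m}. node i / (node i - node m)))"
    using inj_on_subset[OF inj_node] degree_interpolant[of n] by (intro lagrange_at_0) auto
  also have "\<dots> = (\<Sum>m\<le>n. fact n ^ 2 * ((-1) ^ m * (4 * of_nat m + 1) *
     (\<Prod>j\<in>{1..n}. ((of_nat j)\<^sup>2 - node m) / (of_nat j)\<^sup>2) * (\<Prod>i\<in>{..n} - {m}. node i /
         (node i - node m))))"
  proof (intro sum.cong refl)
    fix m assume "m \<in> {..n}"
    have "(\<Prod>j\<in>{1..n}. (of_nat j :: rat)\<^sup>2) = fact n ^ 2"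
      by (simp add: fact_prod prod_power_distrib)
    then have "(\<Prod>j\<in>{1..n}. ((of_nat j)\<^sup>2 - node m) / (of_nat j)\<^sup>2) =
        (\<Prod>j<n. (of_nat (Suc j))\<^sup>2 - node m) / fact n ^ 2"
      by (simp add: prod_dividef prod.atLeast1_atMost_eq)
    with \<open>m \<in> {..n}\<close> show "poly (interpolant n) (node m) * (\<Prod>i\<in>{..n} - {m}. node i /
        (node i - node m)) =
       fact n ^ 2 * ((-1) ^ m * (4 * of_nat m + 1) *
     (\<Prod>j\<in>{1..n}. ((of_nat j)\<^sup>2 - node m) / (of_nat j)\<^sup>2) * (\<Prod>i\<in>{..n} - {m}. node i /
         (node i - node m)))"
      by (simp add: interpolant_node)
  qed
  finally show ?thesis
    unfolding sum_distrib_left[symmetric] by (simp only: mult_cancel_left) simp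
qed

subsection \<open>Euler polynomials\<close>

lemma euler_poly_egf_mult: "euler_poly_egf x * (fps_exp 1 + 1) = (2 *
    fps_exp x :: 'a :: field_char_0 fps)"
proof -
  have "fps_nth (fps_exp 1 + 1 :: 'a fps) 0 \<noteq> 0"
    by simp
  then show ?thesis
    by (simp add: euler_poly_egf_def fps_divide_unit mult.assoc inverse_mult_eq_1)
qed

lemma fps_exp_plus_1_nonzero: "fps_exp 1 + 1 \<noteq> (0 :: 'a :: field_char_0 fps)"
proof
  assume "fps_exp 1 + 1 = (0 :: 'a fps)"
  from arg_cong[OF this, of "\<lambda>f. fps_nth f 0"] show False
    by simp
qed

lemma euler_poly_egf_eqI:
  assumes "A * (fps_exp 1 + 1) = (2 * fps_exp x :: 'a :: field_char_0 fps)"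
  shows "euler_poly_egf x = A"
  using assms euler_poly_egf_mult[of x] fps_exp_plus_1_nonzero by (metis mult_right_cancel)

lemma euler_poly_egf_conv_0: "euler_poly_egf x = euler_poly_egf 0 *
    (fps_exp x :: 'a :: field_char_0 fps)"
  by (rule euler_poly_egf_eqI) (use euler_poly_egf_mult[of "0 :: 'a"] in \<open>simp add: mult_ac\<close>)

text \<open>Replacing \<open>x\<close> by \<open>x + 1\<close> multiplies the generating function by
  \<open>e^t\<close>; the sum of both is \<open>e^t + 1\<close> times the generating
  function.\<close>

lemma euler_poly_shift: "euler_poly k (x + 1) + euler_poly k x = (2 * x ^ k :: 'a :: field_char_0)"
proof -
  have "euler_poly_egf (x + 1) = euler_poly_egf x * fps_exp 1"
    by (subst (1 2) euler_poly_egf_conv_0) (simp add: fps_exp_add_mult mult.assoc)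
  then have "euler_poly_egf (x + 1) + euler_poly_egf x = 2 * fps_exp x"
    using euler_poly_egf_mult[of x] by (simp add: algebra_simps)
  from arg_cong[OF this, of "\<lambda>f. fact k * fps_nth f k"] show ?thesis
    by (simp add: euler_poly_def ring_distribs numeral_fps_const)
qed

text \<open>The generating function \<open>G(t)\<close> at \<open>x = 0\<close> satisfies
  \<open>G(t) + G(-t) = 2\<close>, which leaves no even coefficient except the constant one.
  \<open>B\<close> is \<open>G(-t)\<close>.\<close>

lemma euler_poly_even_0:
  assumes "even k" "0 < k"
  shows "euler_poly k 0 = (0 :: 'a :: field_char_0)"
proof -
  define B where "B = euler_poly_egf (0 :: 'a) oo (fps_const (-1) * fps_X)"
  have "(euler_poly_egf 0 * (fps_exp 1 + 1)) oo (fps_const (-1) * fps_X) =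
      (2 :: 'a fps) oo (fps_const (-1) * fps_X)"
    using euler_poly_egf_mult[of "0 :: 'a"] by simp
  then have "B * (fps_exp (-1) + 1) = 2"
    by (simp add: B_def fps_compose_mult_distrib fps_compose_add_distrib fps_exp_compose_linear
        numeral_fps_const)
  moreover have "fps_exp 1 * fps_exp (-1) = (1 :: 'a fps)"
    by (simp flip: fps_exp_add_mult)
  ultimately have B: "B * (1 + fps_exp 1) = 2 * fps_exp 1"
    by (metis (no_types, opaque_lifting) distrib_left mult.assoc mult.commute mult.right_neutral)
  have "(euler_poly_egf 0 + B) * (fps_exp 1 + 1) = euler_poly_egf 0 * (fps_exp 1 + 1) + B * (1 +
      fps_exp 1)"
    by (simp add: algebra_simps)
  also have "\<dots> = 2 * (fps_exp 1 + 1)"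
    unfolding euler_poly_egf_mult B by (simp add: algebra_simps)
  finally have "euler_poly_egf 0 + B = 2"
    using fps_exp_plus_1_nonzero by (metis mult_right_cancel)
  from arg_cong[OF this, of "\<lambda>f. fps_nth f k"] assms show ?thesis
    by (simp add: B_def fps_nth_compose_linear euler_poly_def numeral_fps_const)
qed

lemma euler_poly_conv_0:
  "euler_poly k x = (\<Sum>i\<le>k. of_nat (k choose i) * euler_poly i 0 * (x :: 'a :: field_char_0) ^ (k - i))"
  unfolding euler_poly_def[of k] euler_poly_egf_conv_0[of x] fps_mult_nth sum_distrib_left
      atLeast0AtMost
  by (intro sum.cong refl) (simp add: euler_poly_def binomial_fact)

text \<open>The difference equation is iterated downwards from 0. Evenness of \<open>k\<close>
  serves twice: for the vanishing at 0 and for \<open>(-i)^k = i^k\<close>.\<close>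

lemma euler_poly_minus_of_nat:
  assumes "even k" "0 < k"
  shows "euler_poly k (- of_nat n) = (2 * (\<Sum>i<n. (-1) ^ i * of_nat (n - i) ^ k) :: 'a :: field_char_0)"
proof (induction n)
  case 0
  with assms show ?case
    by (simp add: euler_poly_even_0)
next
  case (Suc n)
  have "euler_poly k (- of_nat (Suc n)) = 2 * (- of_nat (Suc n)) ^ k - (euler_poly k (- of_nat n) ::
      'a)"
    using euler_poly_shift[of k "- of_nat (Suc n) :: 'a"] by (simp add: algebra_simps)
  also have "\<dots> = 2 * (of_nat (Suc n) ^ k + (\<Sum>i<n. (-1) ^ Suc i * of_nat (n - i) ^ k))"
    unfolding Suc power_minus_even[OF assms(1)] by (simp add: right_diff_distrib sum_negf)
  finally show ?case
    unfolding sum.lessThan_Suc_shift by simp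
qed

subsection \<open>Congruences between rational numbers\<close>

locale rat_localization =
  fixes p :: nat
  assumes prime: "prime p"
begin

text \<open>The reduced denominator divides every denominator of the same fraction. Closure under
  the ring operations can then be checked on unreduced fractions.\<close>

lemma p_integral_divide:
  assumes "coprime b (int p)"
  shows "of_int a / of_int b \<in> p_integral_rats p"
proof -
  obtain r s where rs: "quotient_of (of_int a / of_int b) = (r, s)"
    by fastforce
  have s: "s > 0" "coprime r s"
    using quotient_of_denom_pos[OF rs] quotient_of_coprime[OF rs] by auto
  have "b \<noteq> 0"
    using assms prime by (auto simp: prime_nat_iff)
  with quotient_of_div[OF rs] s(1) have "of_int (r * b) = (of_int (a * s) :: rat)"
    by (simp add: field_simps)
  then have "r * b = a * s"
    by (simp only: of_int_eq_iff)
  then have "s dvd b"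
    using s(2) by (metis coprime_commute coprime_dvd_mult_right_iff dvd_triv_right)
  with assms have "coprime s (int p)"
    by (meson coprime_divisors dvd_refl)
  with rs show ?thesis
    by (simp add: p_integral_rats_def)
qed

lemma p_integral_cases:
  assumes "x \<in> p_integral_rats p"
  obtains a b where "coprime b (int p)" "b \<noteq> 0" "x = of_int a / of_int b"
proof -
  obtain r s where rs: "quotient_of x = (r, s)"
    by fastforce
  with assms have "coprime s (int p)" "s \<noteq> 0" "x = of_int r / of_int s"
    using quotient_of_denom_pos[OF rs] quotient_of_div[OF rs] by (auto simp: p_integral_rats_def)
  with that show thesis
    by blast
qed

lemma p_integral_of_int [simp, intro]: "of_int a \<in> p_integral_rats p"
  using p_integral_divide[of 1 a] by simp

lemma p_integral_of_nat [simp, intro]: "of_nat a \<in> p_integral_rats p"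
  using p_integral_of_int[of "int a"] by simp

lemma p_integral_numeral [simp, intro]: "numeral w \<in> p_integral_rats p"
  using p_integral_of_int[of "numeral w"] by simp

lemma p_integral_0 [simp, intro]: "0 \<in> p_integral_rats p"
  and p_integral_1 [simp, intro]: "1 \<in> p_integral_rats p"
  using p_integral_of_int[of 0] p_integral_of_int[of 1] by simp_all

lemma p_integral_inverse [intro]:
  assumes "\<not> int p dvd b"
  shows "inverse (of_int b) \<in> p_integral_rats p"
proof -
  have "coprime b (int p)"
    using assms prime by (metis coprime_commute prime_imp_coprime prime_nat_int_transfer)
  from p_integral_divide[OF this, of 1] show ?thesis
    by (simp add: inverse_eq_divide)
qed

lemma p_integral_mult [intro]:
  assumes "x \<in> p_integral_rats p" "y \<in> p_integral_rats p"
  shows "x * y \<in> p_integral_rats p"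
proof -
  from assms obtain a b c d where "coprime b (int p)" "x = of_int a / of_int b"
    "coprime d (int p)" "y = of_int c / of_int d"
    by (metis p_integral_cases)
  with p_integral_divide[of "b * d" "a * c"] show ?thesis
    by simp
qed

lemma p_integral_divide_nat [intro]:
  assumes "x \<in> p_integral_rats p" "\<not> p dvd b"
  shows "x / of_nat b \<in> p_integral_rats p"
  using p_integral_mult[OF assms(1) p_integral_inverse[of "int b"]] assms(2)
  by (simp add: divide_inverse)

lemma p_integral_add [intro]:
  assumes "x \<in> p_integral_rats p" "y \<in> p_integral_rats p"
  shows "x + y \<in> p_integral_rats p"
proof -
  from assms obtain a b c d where "coprime b (int p)" "b \<noteq> 0" "x = of_int a / of_int b"
    "coprime d (int p)" "d \<noteq> 0" "y = of_int c / of_int d"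
    by (metis p_integral_cases)
  with p_integral_divide[of "b * d" "a * d + c * b"] show ?thesis
    by (simp add: add_divide_distrib)
qed

lemma p_integral_minus [intro]:
  assumes "x \<in> p_integral_rats p"
  shows "- x \<in> p_integral_rats p"
  using p_integral_mult[OF p_integral_of_int[of "-1"] assms] by simp

lemma p_integral_diff [intro]:
  assumes "x \<in> p_integral_rats p" "y \<in> p_integral_rats p"
  shows "x - y \<in> p_integral_rats p"
  using p_integral_add[OF assms(1) p_integral_minus[OF assms(2)]] by simp

lemma p_integral_power [intro]:
  assumes "x \<in> p_integral_rats p"
  shows "x ^ n \<in> p_integral_rats p"
  using assms by (induction n) auto

lemma p_integral_sum [intro]:
  assumes "\<And>i. i \<in> A \<Longrightarrow> f i \<in> p_integral_rats p"
  shows "sum f A \<in> p_integral_rats p"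
  using assms by (induction A rule: infinite_finite_induct) auto

lemma p_integral_prod [intro]:
  assumes "\<And>i. i \<in> A \<Longrightarrow> f i \<in> p_integral_rats p"
  shows "prod f A \<in> p_integral_rats p"
  using assms by (induction A rule: infinite_finite_induct) auto

section \<open>Congruence modulo powers of \<open>p\<close>\<close>

abbreviation pcong :: "nat \<Rightarrow> rat \<Rightarrow> rat \<Rightarrow> bool" where
  "pcong k \<equiv> rat_cong_prime_power p k"

lemma pcongI:
  assumes "x - y = of_nat p ^ k * z" "z \<in> p_integral_rats p"
  shows "pcong k x y"
  using assms by (auto simp: rat_cong_prime_power_def)

lemma pcongE:
  assumes "pcong k x y"
  obtains z where "z \<in> p_integral_rats p" "x = y + of_nat p ^ k * z"
  using assms by (auto simp: rat_cong_prime_power_def algebra_simps)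

lemma pcong_p_integral: "pcong k x y \<Longrightarrow> y \<in> p_integral_rats p \<Longrightarrow> x \<in> p_integral_rats p"
  by (elim pcongE) auto

lemma pcong_refl [simp, intro]: "pcong k x x"
  by (rule pcongI[of _ _ _ 0]) auto

lemma pcong_sym: "pcong k x y \<Longrightarrow> pcong k y x"
  by (elim pcongE, rule pcongI[of _ _ _ "- z" for z]) auto

lemma pcong_add: "pcong k x y \<Longrightarrow> pcong k u v \<Longrightarrow> pcong k (x + u) (y + v)"
  by (elim pcongE, rule pcongI[of _ _ _ "z + w" for z w]) (auto simp: distrib_left)

lemma pcong_trans [trans]: "pcong k x y \<Longrightarrow> pcong k y z \<Longrightarrow> pcong k x z"
  using pcong_add[of k x y y z] by (simp add: rat_cong_prime_power_def)

lemma pcong_sum: "(\<And>i. i \<in> A \<Longrightarrow> pcong k (f i) (g i)) \<Longrightarrow> pcong k (sum f A) (sum g A)"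
  by (induction A rule: infinite_finite_induct) (auto intro: pcong_add)

text \<open>A prefactor \<open>p ^ l\<close> raises the modulus, so congruences modulo
  \<open>p\<close> of cofactors suffice for results modulo \<open>p^4\<close>.\<close>

lemma pcong_scale:
  assumes "pcong k x y" "c \<in> p_integral_rats p"
  shows "pcong (l + k) (of_nat p ^ l * c * x) (of_nat p ^ l * c * y)"
  using assms(1)
proof (rule pcongE)
  fix z assume "z \<in> p_integral_rats p" "x = y + of_nat p ^ k * z"
  with assms(2) show ?thesis
    by (intro pcongI[of _ _ _ "c * z"]) (auto simp: algebra_simps power_add)
qed

lemma pcong_mult_left:
  assumes "pcong k x y" "c \<in> p_integral_rats p"
  shows "pcong k (c * x) (c * y)"
  using pcong_scale[OF assms, of 0] by simp

text \<open>By \<open>x * u - y * v = x * (u - v) + v * (x - y)\<close>, whence the integrality of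
  \<open>x\<close> and \<open>v\<close>.\<close>

lemma pcong_mult:
  assumes "pcong k x y" "pcong k u v" "x \<in> p_integral_rats p" "v \<in> p_integral_rats p"
  shows "pcong k (x * u) (y * v)"
  using pcong_trans[OF pcong_mult_left[OF assms(2,3)] pcong_mult_left[OF assms(1,4), unfolded
      mult.commute[of v]]] .

lemma pcong_power:
  assumes "pcong k x y" "x \<in> p_integral_rats p" "y \<in> p_integral_rats p"
  shows "pcong k (x ^ n) (y ^ n)"
  using assms by (induction n) (auto intro!: pcong_mult p_integral_power)

lemma pcong_prod_1:
  assumes "\<And>i. i \<in> A \<Longrightarrow> pcong k (f i) 1"
  shows "pcong k (prod f A) 1"
  using assms
proof (induction A rule: infinite_finite_induct)
  case (insert i A)
  then have "pcong k (f i * prod f A) (1 * 1)"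
    by (intro pcong_mult) (auto intro: pcong_p_integral)
  with insert show ?case
    by simp
qed auto

lemma pcong_of_int: "[a = b] (mod int p) \<Longrightarrow> pcong 1 (of_int a) (of_int b)"
proof -
  assume "[a = b] (mod int p)"
  then obtain c where "a = b + int p * c"
    by (metis cong_iff_lin cong_sym)
  then show ?thesis
    by (intro pcongI[of _ _ _ "of_int c"]) auto
qed

end

subsection \<open>The truncated sum\<close>

locale prime_1_mod_4 = rat_localization +
  fixes n :: nat
  assumes p_eq: "p = 4 * n + 1"
begin

section \<open>Consequences of \<open>p = 4 * n + 1\<close>\<close>

lemma n_pos: "0 < n"
  using prime p_eq by (cases n) auto

lemma p_ge_5: "5 \<le> p"
  using n_pos p_eq by simp

lemma not_dvd_less: "0 < j \<Longrightarrow> j < p \<Longrightarrow> \<not> p dvd j"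
  using nat_dvd_not_less by blast

lemma not_dvd_2_power: "\<not> p dvd 2 ^ k"
proof
  assume "p dvd 2 ^ k"
  with prime have "p dvd 2"
    by (rule prime_dvd_power)
  with p_ge_5 show False
    by (auto dest: dvd_imp_le)
qed

lemma p_integral_divide_2_power:
  assumes "x \<in> p_integral_rats p"
  shows "x / 2 \<in> p_integral_rats p" "x / 4 \<in> p_integral_rats p" "x / 16 \<in> p_integral_rats p"
  using p_integral_divide_nat[OF assms not_dvd_2_power[of 1]] p_integral_divide_nat[OF assms
      not_dvd_2_power[of 2]]
    p_integral_divide_nat[OF assms not_dvd_2_power[of 4]] by simp_all

lemma p_integral_quarter: "1/4 \<in> p_integral_rats p"
  by (rule p_integral_divide_2_power) simp

lemma of_nat_p: "(of_nat p :: rat) = 4 * of_nat n + 1"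
  by (simp add: p_eq)

lemma node_n: "node n = of_nat p ^ 2 / 16"
  by (simp add: node_def of_nat_p power2_eq_square field_simps)

lemma p_integral_node: "node m \<in> p_integral_rats p"
  unfolding node_def using p_integral_quarter by (intro p_integral_power p_integral_add) auto

text \<open>The factor at \<open>j\<close> of the first product is paired with the Lagrange factor
  at \<open>i = n - j\<close>. Since \<open>node (n - j)\<close> is congruent to \<open>j^2\<close>
  modulo \<open>p\<close>, the two nearly cancel.\<close>

definition factor :: "nat \<Rightarrow> nat \<Rightarrow> rat" where
  "factor m j = ((of_nat j)\<^sup>2 - node m) / (of_nat j)\<^sup>2 * (node (n - j) / (node (n - j) - node m))"

lemma prod_factor:
  "(\<Prod>j\<in>A. factor m j) =
     (\<Prod>j\<in>A. ((of_nat j)\<^sup>2 - node m) / (of_nat j)\<^sup>2) * (\<Prod>j\<in>A. node (n - j) / (node (n - j) - node m))"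
  by (simp only: factor_def prod.distrib)

text \<open>With \<open>i = n - j\<close>, \<open>factor m j - 1\<close> is
  \<open>node m * (j^2 - node i) / (j^2 * (node i - node m))\<close>, and
  \<open>16 * (j^2 - node i) = p * (8 * j - p)\<close>. The factor \<open>node m\<close> is kept
  visible because it equals \<open>p^2/16\<close> at \<open>m = n\<close>.\<close>

lemma factor_expansion:
  assumes "m \<le> n" "j \<in> {1..n} - {n - m}"
  obtains c where "c \<in> p_integral_rats p" "factor m j = 1 + of_nat p * node m * c"
proof -
  define i where "i = n - j"
  have i: "i + j = n" "i \<noteq> m" "0 < j"
    using assms by (auto simp: i_def)
  \<comment> \<open>The denominator times 16, as an integer. It is prime to \<open>p\<close>, since
    \<open>i < n\<close> gives \<open>2 * (i + m) + 1 < p\<close>.\<close>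
  define b where "b = 8 * int j ^ 2 * (int i - int m) * (2 * (int i + int m) + 1)"
  have "\<not> int p dvd int i - int m"
    using dvd_imp_le_int[of "int i - int m" "int p"] i assms p_eq by auto
  moreover have "\<not> int p dvd 2 * (int i + int m) + 1"
    using i assms p_eq by (intro notI) (auto dest!: zdvd_imp_le)
  moreover have "\<not> int p dvd int j"
    using i not_dvd_less[of j] p_eq by (subst int_dvd_int_iff) auto
  moreover have "\<not> int p dvd int (2 ^ 3)"
    unfolding int_dvd_int_iff by (rule not_dvd_2_power)
  moreover have "prime (int p)"
    using prime by simp
  ultimately have b: "\<not> int p dvd b"
    unfolding b_def power2_eq_square by (simp add: prime_dvd_mult_iff del: of_nat_add)
  then have "b \<noteq> 0"
    by auto
  then have nz: "node i - node m \<noteq> 0" "(of_nat j :: rat) \<noteq> 0" "of_int b \<noteq> (0 :: rat)"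
    using i inj_node by (auto simp: inj_def)
  have b': "(of_int b :: rat) = 16 * (of_nat j)\<^sup>2 * (node i - node m)"
    by (simp add: b_def node_diff field_simps)
  have n: "(of_nat n :: rat) = of_nat i + of_nat j"
    using i by (metis of_nat_add)
  have d: "16 * ((of_nat j)\<^sup>2 - node i) = (of_nat p :: rat) * (8 * of_nat j - of_nat p)"
    by (simp add: node_def of_nat_p n power2_eq_square field_simps)
  have "factor m j - 1 = node m * ((of_nat j)\<^sup>2 - node i) / ((of_nat j)\<^sup>2 * (node i - node m))"
    using nz unfolding factor_def i_def[symmetric] by (simp add: field_simps)
  also have "\<dots> = node m * (16 * ((of_nat j)\<^sup>2 - node i)) / of_int b"
  proof -
    have "x * y / (u * v) = x * (16 * y) / (16 * u * v)" for u v x y :: rat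
      by simp
    then show ?thesis
      unfolding b' .
  qed
  also have "\<dots> = of_nat p * node m * (of_int (8 * int j - int p) * inverse (of_int b))"
    unfolding d by (simp add: divide_inverse)
  finally have "factor m j = 1 + of_nat p * node m * (of_int (8 * int j - int p) * inverse (of_int b))"
    by (simp only: diff_eq_eq add.commute)
  moreover have "of_int (8 * int j - int p) * inverse (of_int b) \<in> p_integral_rats p"
    using b by (intro p_integral_mult p_integral_inverse p_integral_of_int)
  ultimately show thesis
    by (rule that[rotated])
qed

lemma prod_factor_cong_1:
  assumes "m \<le> n"
  shows "pcong 1 (\<Prod>j\<in>{1..n} - {n - m}. factor m j) 1"
proof (rule pcong_prod_1)
  fix j assume "j \<in> {1..n} - {n - m}"
  then obtain c where "c \<in> p_integral_rats p" "factor m j = 1 + of_nat p * node m * c"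
    using assms by (elim factor_expansion[rotated])
  then show "pcong 1 (factor m j) 1"
    using p_integral_node by (intro pcongI[of _ _ _ "node m * c"]) auto
qed

text \<open>Here \<open>node n = p^2/16\<close> improves the error from \<open>p\<close> to
  \<open>p^3\<close>. The removed index \<open>n - n = 0\<close> lies outside \<open>{1..n}\<close>,
  so this is the full product.\<close>

lemma prod_factor_n_cong_1: "pcong 3 (\<Prod>j\<in>{1..n} - {n - n}. factor n j) 1"
proof (rule pcong_prod_1)
  fix j assume "j \<in> {1..n} - {n - n}"
  then obtain c where "c \<in> p_integral_rats p" "factor n j = 1 + of_nat p * node n * c"
    by (elim factor_expansion[OF order_refl])
  then show "pcong 3 (factor n j) 1"
    using p_integral_divide_2_power(3)[of c]
    by (intro pcongI[of _ _ _ "c / 16"]) (auto simp: node_n power2_eq_square power3_eq_cube)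
qed

section \<open>The terms of the interpolation formula modulo \<open>p^4\<close>\<close>

abbreviation lagrange_term :: "nat \<Rightarrow> rat" where
  "lagrange_term m \<equiv> (-1) ^ m * (4 * of_nat m + 1) *
     (\<Prod>j\<in>{1..n}. ((of_nat j)\<^sup>2 - node m) / (of_nat j)\<^sup>2) * (\<Prod>i\<in>{..n} - {m}. node i / (node i - node m))"

lemma lagrange_term_n: "pcong 4 (lagrange_term n) (of_nat p * (-1) ^ n)"
proof -
  have "(\<Prod>i\<in>{..n} - {n}. node i / (node i - node n)) = (\<Prod>j\<in>{1..n}. node (n - j) /
      (node (n - j) - node n))"
    by (rule prod.reindex_bij_witness[of _ "\<lambda>j. n - j" "\<lambda>i. n - i"]) auto
  then have eq: "lagrange_term n = of_nat p ^ 1 * (-1) ^ n * (\<Prod>j\<in>{1..n} - {n - n}. factor n j)"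
    by (simp add: prod_factor of_nat_p)
  show ?thesis
    unfolding eq using pcong_scale[OF prod_factor_n_cong_1, of "(-1) ^ n" 1]
    by (simp add: p_integral_power p_integral_minus)
qed

text \<open>Two factors remain unpaired: \<open>j = n - m\<close>, whose partner would be the
  excluded node \<open>m\<close>, and the node \<open>n\<close>, whose partner would be
  \<open>j = 0\<close>. They contribute \<open>p\<close> and \<open>p^2\<close>, so everything else
  matters only modulo \<open>p\<close>.\<close>

lemma lagrange_term_less:
  assumes "m < n"
  shows "pcong 4 (lagrange_term m) (of_nat p ^ 3 / 16 * ((-1) ^ m * (2 / (of_nat (n - m))\<^sup>2)))"
proof -
  define J where "J = n - m"
  have J: "J \<in> {1..n}" "0 < J" "J < p" "m + J = n"
    using assms p_eq by (auto simp: J_def)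
  \<comment> \<open>\<open>4 * m + 1\<close> times the unpaired factors, divided by
    \<open>p^3/16\<close>. Setting \<open>p = 0\<close> formally in \<open>w\<close> gives
    \<open>2 / J^2\<close>.\<close>
  define w where "w = (of_nat p - 4 * of_nat J) * (8 * of_nat J - of_nat p) / (of_nat (8 * J ^ 3) *
      (of_nat p - 2 * of_nat J) :: rat)"
  define R where "R = (\<Prod>j\<in>{1..n} - {J}. factor m j)"
  have m: "(of_nat m :: rat) = (of_nat p - 1) / 4 - of_nat J"
    using J(4) by (simp add: of_nat_p field_simps flip: of_nat_add)
  have pJ: "0 < (of_nat p - 2 * of_nat J :: rat)"
  proof -
    have "of_nat (2 * J) < (of_nat p :: rat)"
      using J p_eq unfolding of_nat_less_iff by auto
    then show ?thesis
      by simp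
  qed
  have "{..n} - {m} = insert n ({..<n} - {m})"
    using assms by auto
  moreover have "(\<Prod>i\<in>{..<n} - {m}. node i / (node i - node m)) = (\<Prod>j\<in>{1..n} - {J}. node (n - j) /
      (node (n - j) - node m))"
    by (rule prod.reindex_bij_witness[of _ "\<lambda>j. n - j" "\<lambda>i. n - i"]) (use J in auto)
  ultimately have "lagrange_term m = (-1) ^ m * ((4 * of_nat m + 1) * (((of_nat J)\<^sup>2 - node m) /
      (of_nat J)\<^sup>2) * (node n / (node n - node m))) * R"
    using J(1) by (simp add: R_def prod_factor prod.remove[of _ J])
  also have "(4 * of_nat m + 1) * (((of_nat J)\<^sup>2 - node m) / (of_nat J)\<^sup>2) * (node n /
      (node n - node m)) = of_nat p ^ 3 / 16 * w"
  proof -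
    have 1: "4 * of_nat m + 1 = (of_nat p - 4 * of_nat J :: rat)"
      unfolding m by (simp add: field_simps)
    have 2: "(of_nat J)\<^sup>2 - node m = of_nat p * (8 * of_nat J - of_nat p) / 16"
      by (simp add: node_def m power2_eq_square field_simps)
    have 3: "node n - node m = of_nat J * (of_nat p - 2 * of_nat J) / 2"
      unfolding node_n by (simp add: node_def m power2_eq_square field_simps)
    have "(P - 4 * x) * (P * (8 * x - P) / 16 / x\<^sup>2) * (P ^ 2 / 16 / (x * (P - 2 * x) / 2)) =
        P ^ 3 / 16 * ((P - 4 * x) * (8 * x - P) / (8 * x ^ 3 * (P - 2 * x)))" for P x :: rat
      by (simp add: power2_eq_square power3_eq_cube)
    then show ?thesis
      unfolding 1 2 3 unfolding node_n w_def by simp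
  qed
  finally have eq: "lagrange_term m = of_nat p ^ 3 * ((-1) ^ m / 16) * (w * R)"
    by simp
  have "pcong 1 w (2 / (of_nat (J\<^sup>2)))"
  proof -
    define b where "b = 8 * J ^ 3 * (p - 2 * J)"
    have "\<not> p dvd 8" "\<not> p dvd J" "\<not> p dvd p - 2 * J"
      using not_dvd_2_power[of 3] J p_eq not_dvd_less[of J] not_dvd_less[of "p - 2 * J"] by auto
    then have b: "\<not> p dvd b"
      unfolding b_def power3_eq_cube prime_dvd_mult_iff[OF prime] by blast
    have b': "of_nat b = (8 * of_nat J ^ 3 * (of_nat p - 2 * of_nat J) :: rat)"
      using J p_eq by (simp add: b_def of_nat_diff)
    have "(P - 4 * x) * (8 * x - P) / (8 * x ^ 3 * (P - 2 * x)) - 2 / x\<^sup>2 = P * ((- 4 * x - P) /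
        (8 * x ^ 3 * (P - 2 * x)))"
      if "P - 2 * x \<noteq> 0" "x \<noteq> 0" for P x :: rat
    proof -
      define D where "D = 8 * x ^ 3 * (P - 2 * x)"
      have D: "2 / x\<^sup>2 = 16 * x * (P - 2 * x) / D"
        using that by (simp add: D_def power2_eq_square power3_eq_cube)
      show ?thesis
        unfolding D D_def[symmetric] diff_divide_distrib[symmetric] times_divide_eq_right
        by (rule arg_cong[of _ _ "\<lambda>y. y / D"]) (simp add: algebra_simps)
    qed
    from this[of "of_nat p" "of_nat J"] have "w - 2 / of_nat (J\<^sup>2) = of_nat p ^ 1 * (of_int (- 4 *
        int J - int p) / of_nat b)"
      using pJ J unfolding b' by (simp add: w_def)
    then show ?thesis
      by (rule pcongI) (intro p_integral_divide_nat p_integral_of_int b)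
  qed
  moreover have "2 / of_nat (J\<^sup>2) \<in> p_integral_rats p"
  proof -
    have "\<not> p dvd J\<^sup>2"
      using prime J not_dvd_less[of J] by (auto dest: prime_dvd_power)
    then show ?thesis
      by (intro p_integral_divide_nat p_integral_numeral)
  qed
  moreover have "pcong 1 R 1"
    using prod_factor_cong_1[of m] assms by (simp add: R_def J_def)
  ultimately have "pcong 1 (w * R) (2 / of_nat (J\<^sup>2) * 1)"
    using pcong_p_integral by (intro pcong_mult) auto
  from pcong_scale[OF this, of "(-1) ^ m / 16" 3] show ?thesis
    using p_integral_divide_2_power(3)[of "(-1) ^ m"] unfolding eq
    by (simp add: J_def p_integral_power p_integral_minus)
qed

lemma truncated_sum_cong:
  "pcong 4 (\<Sum>k\<le>n. summand k)
     (of_nat p * (-1) ^ n + of_nat p ^ 3 / 16 * (\<Sum>m<n. (-1) ^ m * (2 / (of_nat (n - m))\<^sup>2)))"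
proof -
  have split: "sum f {..n} = f n + sum f {..<n}" for f :: "nat \<Rightarrow> rat"
    by (simp flip: lessThan_Suc_atMost)
  have "pcong 4 (lagrange_term n + (\<Sum>m<n. lagrange_term m))
      (of_nat p * (-1) ^ n + (\<Sum>m<n. of_nat p ^ 3 / 16 * ((-1) ^ m * (2 / (of_nat (n - m))\<^sup>2))))"
    by (intro pcong_add pcong_sum lagrange_term_n lagrange_term_less) auto
  then show ?thesis
    unfolding truncated_sum_eq split[of lagrange_term] sum_distrib_left[of "of_nat p ^ 3 / 16"] .
qed

text \<open>The difference equation at 0, with the value at 1 expanded by the binomial formula, is a
  recursion that divides only by 2.\<close>

lemma p_integral_euler_poly_0: "euler_poly k 0 \<in> p_integral_rats p"
proof (induction k rule: less_induct)
  case (less k)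
  have "2 * euler_poly k 0 = 2 * 0 ^ k - (\<Sum>i<k. of_nat (k choose i) * euler_poly i (0 :: rat))"
    using euler_poly_shift[of k "0 :: rat"] euler_poly_conv_0[of k "1 :: rat"]
    by (simp flip: lessThan_Suc_atMost)
  then have "euler_poly k 0 = (2 * 0 ^ k - (\<Sum>i<k. of_nat (k choose i) * euler_poly i (0 :: rat))) / 2"
    by simp
  also have "\<dots> \<in> p_integral_rats p"
    using less by (intro p_integral_divide_2_power p_integral_diff p_integral_mult p_integral_sum
        p_integral_power) auto
  finally show ?case .
qed

lemma euler_poly_cong:
  assumes "pcong e x y" "x \<in> p_integral_rats p" "y \<in> p_integral_rats p"
  shows "pcong e (euler_poly k x) (euler_poly k y)"
  unfolding euler_poly_conv_0[of k x] euler_poly_conv_0[of k y]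
  using assms p_integral_euler_poly_0 by (intro pcong_sum pcong_mult_left pcong_power
      p_integral_mult) auto

text \<open>Fermat's little theorem divided by \<open>j^2\<close>.\<close>

lemma power_p_minus_3_cong:
  assumes "0 < j" "j < p"
  shows "pcong 1 (1 / (of_nat j)\<^sup>2) (of_nat j ^ (p - 3))"
proof -
  have j: "\<not> p dvd j"
    using assms by (rule not_dvd_less)
  then have "[j ^ (p - 1) = 1] (mod p)"
    by (rule fermat_theorem[OF prime])
  then have "[int (j ^ (p - 1)) = int 1] (mod int p)"
    by (simp only: cong_int_iff)
  then have "pcong 1 (of_nat j ^ (p - 1)) 1"
    using pcong_of_int[of "int (j ^ (p - 1))" "int 1"] by simp
  moreover have "\<not> p dvd j\<^sup>2"
    using prime j by (auto dest: prime_dvd_power)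
  ultimately have "pcong 1 (1 / of_nat (j\<^sup>2) * of_nat j ^ (p - 1)) (1 / of_nat (j\<^sup>2) * 1)"
    by (intro pcong_mult_left p_integral_divide_nat) auto
  moreover have "p - 1 = 2 + (p - 3)"
    using p_ge_5 by simp
  then have "1 / of_nat (j\<^sup>2) * of_nat j ^ (p - 1) = (of_nat j ^ (p - 3) :: rat)"
    using assms by (simp only: power_add) simp
  ultimately show ?thesis
    using pcong_sym by simp
qed

lemma euler_poly_quarter_cong:
  "pcong 1 (\<Sum>m<n. (-1) ^ m * (2 / (of_nat (n - m))\<^sup>2)) (euler_poly (p - 3) (1/4))"
proof -
  have "pcong 1 ((-1) ^ m * (2 / (of_nat (n - m))\<^sup>2)) (2 * ((-1) ^ m * of_nat (n - m) ^ (p - 3)))"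
      if "m < n" for m
  proof -
    have "pcong 1 (2 * (-1) ^ m * (1 / (of_nat (n - m))\<^sup>2)) (2 * (-1) ^ m * of_nat (n - m) ^ (p - 3))"
    proof (intro pcong_mult_left power_p_minus_3_cong p_integral_mult p_integral_power p_integral_minus)
      show "0 < n - m" "n - m < p"
        using that p_eq by auto
    qed auto
    then show ?thesis
      by (simp add: mult_ac)
  qed
  then have "pcong 1 (\<Sum>m<n. (-1) ^ m * (2 / (of_nat (n - m))\<^sup>2)) (\<Sum>m<n. 2 * ((-1) ^ m *
      of_nat (n - m) ^ (p - 3)))"
    by (intro pcong_sum) auto
  \<comment> \<open>The exponent \<open>p - 3 = 4 * n - 2\<close> is even and positive.\<close>
  also have "(\<Sum>m<n. 2 * ((-1) ^ m * of_nat (n - m) ^ (p - 3))) = euler_poly (p - 3) (- of_nat n :: rat)"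
    using n_pos p_eq by (subst euler_poly_minus_of_nat) (auto simp: sum_distrib_left)
  also have "pcong 1 \<dots> (euler_poly (p - 3) (1/4))"
  proof (rule euler_poly_cong)
    show "pcong 1 (- of_nat n) (1/4)"
      \<comment> \<open>The witness comes from \<open>- n - 1/4 = - p/4\<close>.\<close>
      using p_integral_minus[OF p_integral_quarter]
          by (intro pcongI[of _ _ _ "- (1/4)"]) (simp_all add: of_nat_p field_simps)
  qed (use p_integral_quarter in auto)
  finally show ?thesis .
qed

lemma truncated_sum_euler_cong:
  "pcong 4 (\<Sum>k\<le>n. summand k) (of_nat p * (-1) ^ n + of_nat p ^ 3 / 16 * euler_poly (p - 3) (1/4))"
proof -
  have "pcong (3 + 1) (of_nat p ^ 3 * (1 / 16) * (\<Sum>m<n. (-1) ^ m * (2 / (of_nat (n - m))\<^sup>2)))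
      (of_nat p ^ 3 * (1 / 16) * euler_poly (p - 3) (1/4))"
    by (intro pcong_scale euler_poly_quarter_cong p_integral_divide_2_power) auto
  then have "pcong 4 (of_nat p ^ 3 / 16 * (\<Sum>m<n. (-1) ^ m * (2 / (of_nat (n - m))\<^sup>2)))
      (of_nat p ^ 3 / 16 * euler_poly (p - 3) (1/4))"
    by simp
  from pcong_trans[OF truncated_sum_cong pcong_add[OF pcong_refl this]] show ?thesis .
qed

subsection \<open>Terms beyond the truncation\<close>

text \<open>For \<open>k > n\<close> the Pochhammer symbol contains the factor
  \<open>1/4 + n = p/4\<close>, so dividing by \<open>p\<close> keeps the quotient integral as long
  as \<open>k < p\<close>.\<close>

definition tail_ratio :: "nat \<Rightarrow> rat" where
  "tail_ratio k = pochhammer (1/4) k / fact k / of_nat p"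

lemma tail_ratio_Suc: "tail_ratio (Suc k) = tail_ratio k * ((1/4 + of_nat k) / of_nat (Suc k))"
  by (simp add: tail_ratio_def pochhammer_Suc field_simps)

lemma p_integral_tail_ratio:
  assumes "n < k" "k < p"
  shows "tail_ratio k \<in> p_integral_rats p"
proof -
  have "Suc n \<le> k"
    using assms by simp
  then show ?thesis
    using assms(2)
  proof (induction k rule: dec_induct)
    case base
    have "tail_ratio (Suc n) = (pochhammer (1/4) n / 4) / of_nat (fact (Suc n))"
    proof -
      have q: "1/4 + of_nat n = (of_nat p / 4 :: rat)"
        by (simp add: of_nat_p)
      show ?thesis
        using p_ge_5 unfolding tail_ratio_def pochhammer_Suc q of_nat_fact by simp
    qed
    moreover have "\<not> p dvd fact (Suc n)"
      unfolding prime_dvd_fact_iff[OF prime] using base by simp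
    moreover have "pochhammer (1/4) n \<in> p_integral_rats p"
      unfolding pochhammer_prod using p_integral_quarter by (intro p_integral_prod p_integral_add) auto
    ultimately show ?case
      by (simp only:) (intro p_integral_divide_nat p_integral_divide_2_power)
  next
    case (step k)
    have "(1/4 + of_nat k) / of_nat (Suc k) \<in> p_integral_rats p"
      using step p_integral_quarter not_dvd_less[of "Suc k"]
          by (intro p_integral_divide_nat p_integral_add) auto
    moreover have "tail_ratio k \<in> p_integral_rats p"
      using step by simp
    ultimately show ?case
      unfolding tail_ratio_Suc by (intro p_integral_mult)
  qed
qed

text \<open>Induction outwards from the centre of the range \<open>n < k < p\<close>, so that one only ever multiplies
  and never has to invert modulo \<open>p\<close>.\<close>

lemma tail_ratio_reflect:
  assumes "a + b = p + n" "n < b" "b \<le> a"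
  shows "pcong 1 (tail_ratio a) ((-1) ^ Suc n * tail_ratio b)"
  using assms
proof (induction "a - b" arbitrary: a b rule: less_induct)
  case less
  have lt: "a < p" "b < p"
    using less.prems by auto
  consider "a = b" | "a = Suc b" | "b + 2 \<le> a"
    using less.prems by linarith
  then show ?case
  proof cases
    case 1
    \<comment> \<open>Here \<open>2 * a = p + n = 5 * n + 1\<close>, so the sign is
      \<open>+1\<close>.\<close>
    with less.prems p_eq have "odd n"
      by presburger
    with 1 show ?thesis
      by simp
  next
    case 2
    with less.prems p_eq have "even n"
      by presburger
    \<comment> \<open>The sign is now \<open>-1\<close>. As \<open>n\<close> is congruent to
      \<open>-1/4\<close>, so is \<open>2 * b + 1\<close>, which makes the ratio of consecutive
      values congruent to \<open>-1\<close>.\<close>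
    have b: "2 * of_nat b + 1 = (of_nat p + of_nat n :: rat)"
      using less.prems(1) 2 by (simp flip: of_nat_add add: mult_2)
    have "(1/4 + of_nat b) / of_nat (Suc b) - (-1) = (2 * of_nat b + 1 + 1/4) / (of_nat (Suc b) :: rat)"
      by (simp add: field_simps)
    also have "\<dots> = of_nat p ^ 1 * (5 / 4 / of_nat (Suc b))"
      unfolding b by (simp add: of_nat_p field_simps)
    finally have "pcong 1 ((1/4 + of_nat b) / of_nat (Suc b)) (-1)"
      using not_dvd_less[of "Suc b"] 2 lt
      by (intro pcongI[of _ _ _ "5 / 4 / of_nat (Suc b)"] p_integral_divide_nat
          p_integral_divide_2_power) auto
    from pcong_mult_left[OF this p_integral_tail_ratio[OF less.prems(2) lt(2)]] \<open>even n\<close> 2 show ?thesis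
      by (simp add: tail_ratio_Suc)
  next
    case 3
    \<comment> \<open>The pair \<open>(c, Suc b)\<close> is closer to the centre. Modulo
      \<open>p\<close>, \<open>1/4 + c\<close> is \<open>- Suc b\<close> and \<open>1/4 + b\<close>
      is \<open>- a\<close>, so the two step ratios multiply to 1.\<close>
    define c where "c = a - 1"
    have c: "a = Suc c" "c + Suc b = p + n" "Suc b \<le> c"
      using 3 less.prems by (auto simp: c_def)
    have "pcong 1 (tail_ratio c) ((-1) ^ Suc n * tail_ratio (Suc b))"
      using c less.prems by (intro less.hyps) auto
    moreover have "(1/4 + of_nat c) / of_nat a \<in> p_integral_rats p"
      using lt c p_integral_quarter not_dvd_less[of a]
          by (intro p_integral_divide_nat p_integral_add) auto
    ultimately have "pcong 1 ((1/4 + of_nat c) / of_nat a * tail_ratio c) ((1/4 + of_nat c) /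
        of_nat a * ((-1) ^ Suc n * tail_ratio (Suc b)))"
      by (rule pcong_mult_left)
    also have "(1/4 + of_nat c) / of_nat a * tail_ratio c = tail_ratio a"
      unfolding c(1) tail_ratio_Suc by (rule mult.commute)
    also have "(1/4 + of_nat c) / of_nat a * ((-1) ^ Suc n * tail_ratio (Suc b)) =
        (-1) ^ Suc n * tail_ratio b * (((1/4 + of_nat c) * (1/4 + of_nat b)) / (of_nat (a * Suc b)))"
      unfolding tail_ratio_Suc of_nat_mult by simp
    also have "pcong 1 \<dots> ((-1) ^ Suc n * tail_ratio b * 1)"
    proof (rule pcong_mult_left)
      have "\<not> p dvd a * Suc b"
        using lt c not_dvd_less[of a] not_dvd_less[of "Suc b"] prime_dvd_mult_iff[OF prime, of a
            "Suc b"] by auto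
      moreover have "(1/4 + of_nat c) * (1/4 + of_nat b) / (of_nat (a * Suc b)) - 1 = of_nat p ^ 1 *
          (- 15 / 16 / of_nat (a * Suc b) :: rat)"
      proof -
        have a: "of_nat a = (5/4 * of_nat p - 1/4 - of_nat b :: rat)" "of_nat c = (5/4 *
            of_nat p - 5/4 - of_nat b :: rat)"
          using arg_cong[OF less.prems(1), of "of_nat :: nat \<Rightarrow> rat"] c(1)
              by (auto simp: of_nat_p field_simps)
        have "(1/4 + of_nat c) * (1/4 + of_nat b) - of_nat (a * Suc b) = (- 15 / 16 * of_nat p :: rat)"
          unfolding of_nat_mult a by (simp add: field_simps)
        moreover have "of_nat (a * Suc b) \<noteq> (0 :: rat)"
          using c by (simp del: of_nat_mult)
        ultimately show ?thesis
          by (simp add: divide_simps del: of_nat_mult)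
      qed
      ultimately show "pcong 1 ((1/4 + of_nat c) * (1/4 + of_nat b) / (of_nat (a * Suc b))) 1"
        using p_integral_of_int[of "- 15"]
        by (intro pcongI[of _ _ _ "- 15 / 16 / of_nat (a *
            Suc b)"] p_integral_divide_nat p_integral_divide_2_power) simp_all
    next
      show "(-1) ^ Suc n * tail_ratio b \<in> p_integral_rats p"
        using less.prems lt by (intro p_integral_mult p_integral_power p_integral_minus
            p_integral_tail_ratio) auto
    qed
    finally show ?thesis
      by simp
  qed
qed

text \<open>The explicit factor \<open>1\<close> fits the shape of
  \<open>pcong_scale\<close>.\<close>

lemma summand_eq_tail_ratio:
  "summand k = of_nat p ^ 3 * 1 * ((-1) ^ k * (8 * of_nat k + 1) * tail_ratio k ^ 3)"
  using p_ge_5 by (simp add: tail_ratio_def power_divide power_mult_distrib)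

text \<open>Reflection contributes the sign \<open>(-1) ^ Suc n\<close> four times, once from
  \<open>(-1) ^ a\<close> and three times from the cube, which cancels; the linear factor changes
  sign once.\<close>

lemma summand_reflect_le:
  assumes "a + b = p + n" "n < b" "b \<le> a"
  shows "pcong 4 (summand a + summand b) 0"
proof -
  have lt: "a < p" "b < p"
    using assms by auto
  have u: "tail_ratio a \<in> p_integral_rats p" "tail_ratio b \<in> p_integral_rats p"
    using assms lt by (auto intro: p_integral_tail_ratio)
  have e: "(-1) ^ a = (-1) ^ Suc n * ((-1) ^ b :: rat)"
  proof -
    have "even a \<longleftrightarrow> even (Suc n + b)"
      using assms(1) p_eq by presburger
    then show ?thesis
      unfolding power_add[symmetric] minus_one_power_iff by simp
  qed
  have "pcong 1 (tail_ratio a ^ 3) (((-1) ^ Suc n * tail_ratio b) ^ 3)"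
    using u by (intro pcong_power tail_ratio_reflect assms p_integral_mult p_integral_power
        p_integral_minus) auto
  \<comment> \<open>The witness 10 comes from
    \<open>8 * (a + b) + 2 = 8 * p + 2 * (4 * n + 1) = 10 * p\<close>.\<close>
  moreover have "pcong 1 (8 * of_nat a + 1) (- (8 * of_nat b + 1))"
    using arg_cong[OF assms(1), of "of_nat :: nat \<Rightarrow> rat"]
    by (intro pcongI[of _ _ _ 10]) (auto simp: of_nat_p)
  ultimately have "pcong 1 ((8 * of_nat a + 1) * tail_ratio a ^ 3) (- (8 * of_nat b + 1) *
      ((-1) ^ Suc n * tail_ratio b) ^ 3)"
    using u by (intro pcong_mult p_integral_power p_integral_mult p_integral_minus p_integral_add) auto
  then have "pcong 1 ((-1) ^ a * ((8 * of_nat a + 1) * tail_ratio a ^ 3)) ((-1) ^ a * (- (8 *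
      of_nat b + 1) * ((-1) ^ Suc n * tail_ratio b) ^ 3))"
    by (intro pcong_mult_left p_integral_power p_integral_minus) auto
  also have "(-1) ^ a * (- (8 * of_nat b + 1) * ((-1) ^ Suc n * tail_ratio b) ^ 3) = - ((-1) ^ b *
      (8 * of_nat b + 1) * tail_ratio b ^ 3)"
  proof -
    have "s * B * (- x * (s * t) ^ 3) = - ((s * s) ^ 2 * (B * x * t ^ 3))" for s B x t :: rat
      by (simp add: power2_eq_square power3_eq_cube)
    from this[of "(-1) ^ Suc n"]
    have "(-1) ^ Suc n * B * (- x * ((-1) ^ Suc n * t) ^ 3) = - ((((-1) ^ Suc n *
        (-1) ^ Suc n)) ^ 2 * (B * x * t ^ 3))" for B x t :: rat .
    moreover have "(-1) ^ Suc n * (-1) ^ Suc n = (1 :: rat)"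
      by (simp flip: power_mult_distrib)
    ultimately show ?thesis
      unfolding e by (simp only: power_one mult_1_left)
  qed
  finally have "pcong 1 ((-1) ^ a * (8 * of_nat a + 1) * tail_ratio a ^ 3 + (-1) ^ b * (8 *
      of_nat b + 1) * tail_ratio b ^ 3) 0"
    using pcong_add[OF _ pcong_refl, of 1 "(-1) ^ a * ((8 * of_nat a + 1) * tail_ratio a ^ 3)"
        "- ((-1) ^ b * (8 * of_nat b + 1) * tail_ratio b ^ 3)" "(-1) ^ b * (8 * of_nat b + 1) *
            tail_ratio b ^ 3"]
    by (simp add: mult.assoc)
  from pcong_scale[OF this, of 1 3] show ?thesis
    unfolding summand_eq_tail_ratio by (simp add: distrib_left)
qed

text \<open>The reflection \<open>k -> p + n - k\<close> permutes the range, so the sum over all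
  reflected pairs is twice the tail, and 2 is invertible modulo \<open>p\<close>. A central index,
  paired with itself, needs no separate treatment.\<close>

lemma tail_sum_cong: "pcong 4 (\<Sum>k\<in>{n<..<p}. summand k) 0"
proof -
  have "pcong 4 (\<Sum>k\<in>{n<..<p}. summand k + summand (p + n - k)) (\<Sum>k\<in>{n<..<p}. 0)"
  proof (rule pcong_sum)
    fix k assume "k \<in> {n<..<p}"
    then show "pcong 4 (summand k + summand (p + n - k)) 0"
      using summand_reflect_le[of k "p + n - k"] summand_reflect_le[of "p + n - k" k]
      by (cases "p + n - k \<le> k") (auto simp: add.commute)
  qed
  moreover have "(\<Sum>k\<in>{n<..<p}. summand (p + n - k)) = (\<Sum>k\<in>{n<..<p}. summand k)"
    by (rule sum.reindex_bij_witness[of _ "\<lambda>k. p + n - k" "\<lambda>k. p + n - k"]) auto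
  ultimately have "pcong 4 (2 * (\<Sum>k\<in>{n<..<p}. summand k)) 0"
    by (simp add: sum.distrib)
  from pcong_mult_left[OF this, of "1/2"] p_integral_divide_2_power(1)[of 1] show ?thesis
    by simp
qed

end

theorem theorem1p2:
  fixes p M :: nat
  assumes "prime p"
    and "p mod 4 = 1"
    and "M = (p - 1) div 4 \<or> M = p - 1"
  shows "rat_cong_prime_power p 4
    (\<Sum>k=0..M. (-1) ^ k * (8 * of_nat k + 1) * pochhammer (1/4 :: rat) k ^ 3 / fact k ^ 3)
    (of_nat p * (-1) ^ ((p - 1) div 4) + of_nat p ^ 3 / 16 * euler_poly (p - 3) (1/4 :: rat))"
proof -
  define n where "n = (p - 1) div 4"
  interpret prime_1_mod_4 p n
  proof
    show "p = 4 * n + 1"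
      using assms(2) unfolding n_def by presburger
  qed fact
  have split: "(\<Sum>k\<le>p - 1. summand k) = (\<Sum>k\<le>n. summand k) + (\<Sum>k\<in>{n<..<p}. summand k)"
    using p_eq by (subst sum.union_disjoint[symmetric]) (auto intro!: sum.cong)
  have "pcong 4 (\<Sum>k\<le>p - 1. summand k) (of_nat p * (-1) ^ n + of_nat p ^ 3 / 16 * euler_poly (p - 3) (1/4))"
    unfolding split using pcong_add[OF truncated_sum_euler_cong tail_sum_cong] by simp
  with assms(3) truncated_sum_euler_cong show ?thesis
    unfolding n_def[symmetric] atLeast0AtMost by blast
qed

end
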